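(* Let $C\in\mathbb{R}^{d\times d}$ be symmetric positive-definite, $\mu_0=\mathcal{N}(0,C)$, and $\rho\colon\mathbb{R}^d\to(0,\infty)$ measurable. Assume there exist $\alpha\in(0,1/\sqrt2]$ and $R>0$ such that $B_{\alpha\|x\|}(0)\subseteq G_{\rho(x)}$ for all $x$ with $\|x\|>R$. Let $E$ be the transition kernel of elliptical slice sampling for $(\rho,\mu_0)$. Then there exist $\delta\in[0,1)$ and $L\in[0,\infty)$ such that $\int_{\mathbb{R}^d}\|y\|\,E(x,\mathrm{d}y)\le\delta\|x\|+L$ for all $x\in\mathbb{R}^d$.
   Context: $\|\cdot\|$ is the Euclidean norm, $B_r(y)=\{z:\|z-y\|\le r\}$, and $G_t=\{x\in\mathbb{R}^d:\rho(x)\ge t\}$ for $t\ge0$. Let $p(x,w,\theta)=\cos(\theta)x+\sin(\theta)w$. Elliptical slice sampling performs one transition from $x$ as follows: draw $w\sim\mu_0$; draw $t\sim\mathcal{U}[0,\rho(x)]$; draw $\theta\sim\mathcal{U}[0,2\pi]$ and set $\theta_{\min}=\theta-2\pi$, $\theta_{\max}=\theta$; while $p(x,w,\theta)\notin G_t$: if $\theta<0$ set $\theta_{\min}=\theta$, else set $\theta_{\max}=\theta$, and draw a new $\theta\sim\mathcal{U}[\theta_{\min},\theta_{\max}]$; output $y=p(x,w,\theta)$. All draws are independent; $E(x,A)$ is the probability that the output lies in $A$. *)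

theory Defs
  imports "HOL-Probability.Probability"
begin

text \<open>Superlevel set G_t = {x. rho x >= t}.\<close>
definition level_set :: "(real^'n \<Rightarrow> real) \<Rightarrow> real \<Rightarrow> (real^'n) set" where
  "level_set \<rho> t = {x. \<rho> x \<ge> t}"

text \<open>The ellipse p(x,w,theta) = cos theta x + sin theta w.\<close>
definition ell :: "real^'n \<Rightarrow> real^'n \<Rightarrow> real \<Rightarrow> real^'n" where
  "ell x w \<theta> = cos \<theta> *\<^sub>R x + sin \<theta> *\<^sub>R w"

text \<open>Centred Gaussian N(0,C) on R^d (d = CARD('n)), given by its Lebesgue density.\<close>
definition gaussian_vec :: "real^'n^'n \<Rightarrow> (real^'n) measure" where
  "gaussian_vec C = density lborel (\<lambda>x. ennreal
     (exp (- (x \<bullet> (matrix_inv C *v x)) / 2) / sqrt ((2 * pi) ^ CARD('n) * det C)))"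

text \<open>Shrinkage bracket: given uniform U[0,1] numbers u 0, u 1, ..., the n-th proposed angle
  together with the current bracket (theta, theta_min, theta_max).  A draw from U[a,b]
  is realised as a + u (b - a) with u uniform on [0,1].  The bracket is updated
  (shrunk) after each rejected proposal; the values after acceptance are irrelevant.\<close>
fun ess_bracket :: "(nat \<Rightarrow> real) \<Rightarrow> nat \<Rightarrow> real \<times> real \<times> real" where
  "ess_bracket u 0 = (2 * pi * u 0, 2 * pi * u 0 - 2 * pi, 2 * pi * u 0)"
| "ess_bracket u (Suc n) =
     (let (\<theta>, a, b) = ess_bracket u n;
          (a', b') = (if \<theta> < 0 then (\<theta>, b) else (a, \<theta>))
      in (a' + u (Suc n) * (b' - a'), a', b'))"

definition ess_theta :: "(nat \<Rightarrow> real) \<Rightarrow> nat \<Rightarrow> real" where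
  "ess_theta u n = fst (ess_bracket u n)"

text \<open>The loop terminates iff some proposed point lies in G_t; the output is the first such point.\<close>
definition ess_terminates :: "(real^'n \<Rightarrow> real) \<Rightarrow> real^'n \<Rightarrow> real^'n \<Rightarrow> real \<Rightarrow> (nat \<Rightarrow> real) \<Rightarrow> bool" where
  "ess_terminates \<rho> x w t u \<longleftrightarrow> (\<exists>n. ell x w (ess_theta u n) \<in> level_set \<rho> t)"

definition ess_output :: "(real^'n \<Rightarrow> real) \<Rightarrow> real^'n \<Rightarrow> real^'n \<Rightarrow> real \<Rightarrow> (nat \<Rightarrow> real) \<Rightarrow> real^'n" where
  "ess_output \<rho> x w t u = ell x w (ess_theta u (LEAST n. ell x w (ess_theta u n) \<in> level_set \<rho> t))"

text \<open>Underlying probability space of one transition from x: independent w ~ mu_0,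
  t ~ U[0, rho x], and an i.i.d. sequence of U[0,1] variables driving the angle draws.\<close>
definition ess_space :: "real^'n^'n \<Rightarrow> (real^'n \<Rightarrow> real) \<Rightarrow> real^'n
     \<Rightarrow> ((real^'n) \<times> real \<times> (nat \<Rightarrow> real)) measure" where
  "ess_space C \<rho> x = gaussian_vec C \<Otimes>\<^sub>M (uniform_measure lborel {0..\<rho> x} \<Otimes>\<^sub>M
       (\<Pi>\<^sub>M i\<in>UNIV. uniform_measure lborel {0..1::real}))"

text \<open>Transition kernel E(x, A) = probability that the output lies in A
  (a non-terminating run produces no output).\<close>
definition ess_kernel :: "real^'n^'n \<Rightarrow> (real^'n \<Rightarrow> real) \<Rightarrow> real^'n \<Rightarrow> (real^'n) measure" where
  "ess_kernel C \<rho> x = measure_of UNIV (sets borel)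
     (\<lambda>A. emeasure (ess_space C \<rho> x)
        {(w, t, u) \<in> space (ess_space C \<rho> x).
           ess_terminates \<rho> x w t u \<and> ess_output \<rho> x w t u \<in> A})"

end

theory Submission
  imports Defs
begin

text \<open>
  The first angle proposed by the sampler is \<open>2 pi u\<^sub>0\<close> with \<open>u\<^sub>0\<close> uniform on [0,1]. With
  probability \<open>\<alpha>/(4 pi)\<close> it lies within \<open>\<alpha>/2\<close> below \<open>pi/2\<close>; then \<open>|cos| \<le> \<alpha>/2\<close> and the proposal
  \<open>cos \<theta> x + sin \<theta> w\<close> has norm at most \<open>\<alpha>/2 |x| + |w|\<close>. If moreover \<open>|x| > R\<close> and
  \<open>|w| \<le> \<alpha>/2 |x|\<close>, the proposal lies in the ball of radius \<open>\<alpha> |x|\<close>, which is contained in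
  \<open>G\<^bsub>\<rho>(x)\<^esub> \<subseteq> G\<^sub>t\<close>, so it is accepted. In every other case the output lies on the ellipse and has
  norm at most \<open>|x| + |w|\<close>, where \<open>|x| \<le> 2/\<alpha> |w|\<close> if \<open>|w| > \<alpha>/2 |x|\<close>. Averaging,
  \<open>E |y| \<le> (1 - (1 - \<alpha>/2) \<alpha>/(4 pi)) |x| + (1 + 2/\<alpha>) E |w| + R\<close>, and \<open>E |w|\<close> is finite because
  \<open>N(0, C)\<close> is the image of the standard Gaussian under any \<open>P\<close> with \<open>C = P P\<^sup>T\<close>, which
  Gram-Schmidt for the inner product \<open>x \<bullet> C y\<close> provides.
\<close>

section \<open>Linear change of variables for Lebesgue measure\<close>

text \<open>
  \<open>Change_Of_Vars\<close> proves \<open>measure_linear_image\<close> only for index types of class \<open>wellorder\<close>;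
  an arbitrary finite index type is transported to a copy ordered through \<open>to_nat\<close>.
\<close>

typedef 'a nat_ordered = "UNIV :: 'a set" by simp

lemma bij_Rep_nat_ordered: "bij Rep_nat_ordered"
  by (metis bij_def inj_def Rep_nat_ordered_inject type_definition.Rep_range type_definition_nat_ordered)

lemma bij_Abs_nat_ordered: "bij Abs_nat_ordered"
  by (metis bij_def inj_def Abs_nat_ordered_inject UNIV_I type_definition.univ type_definition_nat_ordered)

instance nat_ordered :: (finite) finite
  by standard (metis finite_imageI finite type_definition.univ type_definition_nat_ordered)

instantiation nat_ordered :: (finite) linorder
begin

definition less_eq_nat_ordered :: "'a nat_ordered \<Rightarrow> 'a nat_ordered \<Rightarrow> bool" where
  "x \<le> y \<longleftrightarrow> to_nat (Rep_nat_ordered x) \<le> to_nat (Rep_nat_ordered y)"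

definition less_nat_ordered :: "'a nat_ordered \<Rightarrow> 'a nat_ordered \<Rightarrow> bool" where
  "x < y \<longleftrightarrow> to_nat (Rep_nat_ordered x) < to_nat (Rep_nat_ordered y)"

instance
  by standard (auto simp: less_eq_nat_ordered_def less_nat_ordered_def
      Rep_nat_ordered_inject[symmetric] dest: injD[OF inj_to_nat])

end

instance nat_ordered :: (finite) wellorder
proof (rule wf_wellorderI)
  show "wf {(x :: 'a nat_ordered, y). x < y}"
    by (rule wf_subset[OF wf_measure[of "\<lambda>x. to_nat (Rep_nat_ordered x)"]])
      (auto simp: less_nat_ordered_def)
qed intro_classes

lemma prod_Rep_nat_ordered: "(\<Prod>i\<in>UNIV. g (Rep_nat_ordered i)) = (\<Prod>j\<in>UNIV. g j)"
  using prod.reindex_bij_betw[OF bij_Rep_nat_ordered] .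

lemma sum_Rep_nat_ordered: "(\<Sum>i\<in>UNIV. g (Rep_nat_ordered i)) = (\<Sum>j\<in>UNIV. g j)"
  using sum.reindex_bij_betw[OF bij_Rep_nat_ordered] .

definition vec_of_ordered :: "real^('n nat_ordered) \<Rightarrow> real^'n" where
  "vec_of_ordered y = (\<chi> j. y $ Abs_nat_ordered j)"

definition mat_to_ordered :: "real^'n^'n \<Rightarrow> real^('n nat_ordered)^('n nat_ordered)" where
  "mat_to_ordered P = (\<chi> i j. P $ Rep_nat_ordered i $ Rep_nat_ordered j)"

lemma matrix_vector_mult_measurable[measurable]:
  "(\<lambda>x. (M :: real^'n^'m) *v x) \<in> borel_measurable borel"
  by (intro borel_measurable_continuous_onI linear_continuous_on matrix_vector_mul_bounded_linear)

lemma vec_of_ordered_measurable[measurable]: "vec_of_ordered \<in> borel_measurable borel"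
proof -
  have "linear vec_of_ordered"
    by (intro linearI) (auto simp: vec_of_ordered_def vec_eq_iff)
  then show ?thesis
    by (intro borel_measurable_continuous_onI linear_continuous_on linear_conv_bounded_linear[THEN iffD1])
qed

lemma vec_of_ordered_mat_to_ordered:
  "vec_of_ordered (mat_to_ordered P *v z) = P *v vec_of_ordered z"
proof -
  have "(\<Sum>k\<in>UNIV. P $ j $ Rep_nat_ordered k * z $ k) = (\<Sum>l\<in>UNIV. P $ j $ l * z $ Abs_nat_ordered l)" for j
    using sum_Rep_nat_ordered[of "\<lambda>l. P $ j $ l * z $ Abs_nat_ordered l"] by (simp add: Rep_nat_ordered_inverse)
  then show ?thesis
    by (simp add: vec_eq_iff vec_of_ordered_def mat_to_ordered_def matrix_vector_mult_def Abs_nat_ordered_inverse)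
qed

lemma det_mat_to_ordered:
  fixes P :: "real^'n^'n"
  shows "det (mat_to_ordered P) = det P"
proof -
  define conj :: "('n \<Rightarrow> 'n) \<Rightarrow> 'n nat_ordered \<Rightarrow> 'n nat_ordered" where
    "conj p = (\<lambda>x. Abs_nat_ordered (p (Rep_nat_ordered x)))" for p
  have conj: "conj p permutes UNIV \<and> sign (conj p) = sign p" if "p permutes UNIV" for p :: "'n \<Rightarrow> 'n"
  proof -
    interpret permutes_bij_finite p UNIV UNIV Abs_nat_ordered Rep_nat_ordered "conj p"
      using that bij_Abs_nat_ordered
      by unfold_locales (simp_all add: conj_def Abs_nat_ordered_inverse)
    show ?thesis using permutes_p' sign_p' by simp
  qed
  have "det P = (\<Sum>p | p permutes UNIV. of_int (sign p) * (\<Prod>i\<in>UNIV. P $ i $ p i))"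
    by (simp add: det_def)
  also have "\<dots> = (\<Sum>q | q permutes UNIV. of_int (sign q) * (\<Prod>i\<in>UNIV. mat_to_ordered P $ i $ q i))"
  proof (rule sum.reindex_bij_witness[where j=conj and i="\<lambda>q y. Rep_nat_ordered (q (Abs_nat_ordered y))"])
    fix p :: "'n \<Rightarrow> 'n" assume "p \<in> {p. p permutes UNIV}"
    then have p: "p permutes UNIV" by simp
    show "(\<lambda>y. Rep_nat_ordered (conj p (Abs_nat_ordered y))) = p"
      by (simp add: conj_def Abs_nat_ordered_inverse)
    show "conj p \<in> {q. q permutes UNIV}" using conj[OF p] by simp
    have "(\<Prod>i\<in>UNIV. mat_to_ordered P $ i $ conj p i) = (\<Prod>i\<in>UNIV. P $ Rep_nat_ordered i $ p (Rep_nat_ordered i))"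
      by (simp add: mat_to_ordered_def conj_def Abs_nat_ordered_inverse)
    then show "of_int (sign (conj p)) * (\<Prod>i\<in>UNIV. mat_to_ordered P $ i $ conj p i)
        = of_int (sign p) * (\<Prod>i\<in>UNIV. P $ i $ p i)"
      using conj[OF p] prod_Rep_nat_ordered[of "\<lambda>i. P $ i $ p i"] by simp
  next
    fix q :: "'n nat_ordered \<Rightarrow> 'n nat_ordered" assume "q \<in> {q. q permutes UNIV}"
    then have "bij q" by (simp add: permutes_bij)
    then have "bij (Rep_nat_ordered \<circ> q \<circ> Abs_nat_ordered)"
      using bij_Abs_nat_ordered bij_Rep_nat_ordered by (intro bij_comp)
    then show "(\<lambda>y. Rep_nat_ordered (q (Abs_nat_ordered y))) \<in> {p. p permutes UNIV}"
      by (simp add: permutes_univ bij_iff comp_def)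
    show "conj (\<lambda>y. Rep_nat_ordered (q (Abs_nat_ordered y))) = q"
      by (simp add: conj_def Rep_nat_ordered_inverse)
  qed
  also have "\<dots> = det (mat_to_ordered P)" by (simp add: det_def)
  finally show ?thesis ..
qed

lemma prod_Basis_vec: "(\<Prod>b\<in>(Basis :: (real^'n) set). v \<bullet> b) = (\<Prod>i\<in>UNIV. v $ i)"
proof -
  have B: "(Basis :: (real^'n) set) = (\<lambda>i. axis i 1) ` UNIV" by (auto simp: Basis_vec_def)
  have "inj (\<lambda>i::'n. axis i (1::real))" by (auto simp: inj_def axis_eq_axis)
  then show ?thesis
    unfolding B by (subst prod.reindex) (simp_all add: cart_eq_inner_axis)
qed

lemma lborel_vec_of_ordered: "distr lborel borel vec_of_ordered = (lborel :: (real^'n) measure)"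
proof (rule lborel_eqI[symmetric])
  fix l u :: "real^'n"
  assume le: "\<And>b. b \<in> Basis \<Longrightarrow> l \<bullet> b \<le> u \<bullet> b"
  let ?l = "\<chi> i. l $ Rep_nat_ordered i" and ?u = "\<chi> i. u $ Rep_nat_ordered i"
  have "(\<forall>j. l $ j < y $ Abs_nat_ordered j \<and> y $ Abs_nat_ordered j < u $ j) \<longleftrightarrow>
      (\<forall>i. l $ Rep_nat_ordered i < y $ i \<and> y $ i < u $ Rep_nat_ordered i)" for y :: "real^'n nat_ordered"
    by (metis Abs_nat_ordered_inverse Rep_nat_ordered_inverse UNIV_I)
  then have "vec_of_ordered -` box l u = box ?l ?u"
    by (auto simp: mem_box_cart vec_of_ordered_def)
  moreover have "l $ j \<le> u $ j" for j
    using le[of "axis j 1"] by (auto simp: Basis_vec_def cart_eq_inner_axis)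
  then have "?l \<bullet> b \<le> ?u \<bullet> b" if "b \<in> Basis" for b
    using that by (auto simp: Basis_vec_def cart_eq_inner_axis[symmetric])
  ultimately have "emeasure (distr lborel borel vec_of_ordered) (box l u) = (\<Prod>b\<in>Basis. (?u - ?l) \<bullet> b)"
    by (subst emeasure_distr) auto
  also have "\<dots> = (\<Prod>i\<in>UNIV. (u - l) $ Rep_nat_ordered i)"
    by (simp add: prod_Basis_vec)
  also have "\<dots> = (\<Prod>b\<in>Basis. (u - l) \<bullet> b)"
    using prod_Rep_nat_ordered[of "\<lambda>i. (u - l) $ i"] by (simp add: prod_Basis_vec)
  finally show "emeasure (distr lborel borel vec_of_ordered) (box l u) = (\<Prod>b\<in>Basis. (u - l) \<bullet> b)" .
qed simp

lemma matrix_inv_inverse: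
  fixes A :: "real^'n^'n"
  assumes "invertible A"
  shows "A ** matrix_inv A = mat 1" and "matrix_inv A ** A = mat 1"
proof -
  have "A ** matrix_inv A = mat 1 \<and> matrix_inv A ** A = mat 1"
    using assms unfolding matrix_inv_def invertible_def by (rule someI_ex)
  then show "A ** matrix_inv A = mat 1" "matrix_inv A ** A = mat 1" by auto
qed

lemma matrix_inv_unique:
  fixes A B :: "real^'n^'n"
  assumes AB: "A ** B = mat 1"
  shows "matrix_inv A = B"
proof -
  have "invertible A" using AB by (auto simp: invertible_right_inverse)
  have "matrix_inv A = matrix_inv A ** (A ** B)" by (simp add: AB)
  also have "\<dots> = (matrix_inv A ** A) ** B" by (simp add: matrix_mul_assoc)
  also have "\<dots> = B" by (simp add: matrix_inv_inverse \<open>invertible A\<close>)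
  finally show ?thesis .
qed

lemma lborel_eq_density_matrix_image:
  fixes Q :: "real^'m::{finite,wellorder}^'m::{finite,wellorder}"
  assumes "det Q \<noteq> 0"
  shows "lborel = density (distr lborel borel ((*v) Q)) (\<lambda>_. ennreal \<bar>det Q\<bar>)"
proof (rule lborel_eqI)
  define Qi where "Qi = matrix_inv Q"
  have "invertible Q" using assms by (simp add: invertible_det_nz)
  then have QQi: "Q ** Qi = mat 1" and QiQ: "Qi ** Q = mat 1"
    by (simp_all add: Qi_def matrix_inv_inverse)
  have det_Qi: "\<bar>det Q\<bar> * \<bar>det Qi\<bar> = 1"
    using arg_cong[OF QQi, of det] by (simp add: det_mul abs_mult[symmetric])
  fix l u :: "real^('m::{finite,wellorder})" assume le: "\<And>b. b \<in> Basis \<Longrightarrow> l \<bullet> b \<le> u \<bullet> b"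
  have preimage: "(*v) Q -` box l u = (*v) Qi ` box l u"
  proof (intro set_eqI iffI)
    fix x assume "x \<in> (*v) Q -` box l u"
    moreover have "x = Qi *v (Q *v x)" by (simp add: matrix_vector_mul_assoc QiQ)
    ultimately show "x \<in> (*v) Qi ` box l u" by auto
  next
    fix x assume "x \<in> (*v) Qi ` box l u"
    then show "x \<in> (*v) Q -` box l u" by (auto simp: matrix_vector_mul_assoc QQi)
  qed
  have image_sets: "(*v) Qi ` box l u \<in> sets lborel"
    unfolding preimage[symmetric] using measurable_sets[OF matrix_vector_mult_measurable[of Q]] by simp
  have "bounded ((*v) Qi ` box l u)"
    by (intro bounded_linear_image bounded_box matrix_vector_mul_bounded_linear)
  then have "emeasure lborel ((*v) Qi ` box l u) = ennreal (measure lborel ((*v) Qi ` box l u))"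
    using emeasure_bounded_finite by (intro emeasure_eq_ennreal_measure) (simp add: less_top)
  also have "measure lborel ((*v) Qi ` box l u) = measure lebesgue ((*v) Qi ` box l u)"
    using image_sets by simp
  also have "measure lebesgue ((*v) Qi ` box l u) = \<bar>det Qi\<bar> * measure lebesgue (box l u)"
    using measure_linear_image[of "(*v) Qi" "box l u"] by simp
  also have "measure lebesgue (box l u) = (\<Prod>b\<in>Basis. (u - l) \<bullet> b)"
    using le by (simp add: measure_lborel_box_eq)
  finally have "emeasure (distr lborel borel ((*v) Q)) (box l u) = ennreal (\<bar>det Qi\<bar> * (\<Prod>b\<in>Basis. (u - l) \<bullet> b))"
    by (subst emeasure_distr) (auto simp: preimage)
  moreover have "0 \<le> (\<Prod>b\<in>Basis. (u - l) \<bullet> b)"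
    using le by (intro prod_nonneg) (auto simp: inner_diff_left)
  ultimately show "emeasure (density (distr lborel borel ((*v) Q)) (\<lambda>_. ennreal \<bar>det Q\<bar>)) (box l u)
      = (\<Prod>b\<in>Basis. (u - l) \<bullet> b)"
    using det_Qi by (simp add: emeasure_density_const ennreal_mult[symmetric] mult.assoc[symmetric])
qed simp

lemma nn_integral_lborel_matrix_change:
  fixes P :: "real^'n^'n" and F :: "real^'n \<Rightarrow> ennreal"
  assumes "det P \<noteq> 0" and [measurable]: "F \<in> borel_measurable borel"
  shows "(\<integral>\<^sup>+ x. F x \<partial>lborel) = ennreal \<bar>det P\<bar> * (\<integral>\<^sup>+ y. F (P *v y) \<partial>lborel)"
proof -
  let ?Q = "mat_to_ordered P" and ?G = "\<lambda>z. F (vec_of_ordered z)"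
  have "(\<integral>\<^sup>+ x. F x \<partial>lborel) = (\<integral>\<^sup>+ z. ?G z \<partial>lborel)"
    by (subst lborel_vec_of_ordered[symmetric]) (simp add: nn_integral_distr)
  also have "\<dots> = (\<integral>\<^sup>+ z. ?G z \<partial>density (distr lborel borel ((*v) ?Q)) (\<lambda>_. ennreal \<bar>det P\<bar>))"
    using lborel_eq_density_matrix_image[of ?Q] assms(1) by (simp add: det_mat_to_ordered)
  also have "\<dots> = ennreal \<bar>det P\<bar> * (\<integral>\<^sup>+ z. F (P *v vec_of_ordered z) \<partial>lborel)"
    by (simp add: nn_integral_density nn_integral_distr nn_integral_cmult vec_of_ordered_mat_to_ordered)
  also have "(\<integral>\<^sup>+ z. F (P *v vec_of_ordered z) \<partial>lborel) = (\<integral>\<^sup>+ y. F (P *v y) \<partial>lborel)"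
    by (subst (2) lborel_vec_of_ordered[symmetric]) (simp add: nn_integral_distr)
  finally show ?thesis .
qed

section \<open>Gaussian measures\<close>

lemma nn_integral_exp_neg_norm_sq:
  fixes \<sigma> :: real
  assumes "0 < \<sigma>"
  shows "(\<integral>\<^sup>+ y. ennreal (exp (- (norm (y :: real^'n))\<^sup>2 / (2 * \<sigma>\<^sup>2))) \<partial>lborel)
    = ennreal (sqrt (2 * pi * \<sigma>\<^sup>2) ^ CARD('n))"
proof -
  have c: "0 < sqrt (2 * pi * \<sigma>\<^sup>2)" using assms by simp
  have "exp (- t\<^sup>2 / (2 * \<sigma>\<^sup>2)) = sqrt (2 * pi * \<sigma>\<^sup>2) * normal_density 0 \<sigma> t" for t
    using c assms by (simp add: normal_density_def)
  moreover have "(\<integral>\<^sup>+ t. ennreal (normal_density 0 \<sigma> t) \<partial>lborel) = 1"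
    using prob_space.emeasure_space_1[OF prob_space_normal_density[OF assms, of 0]]
    by (simp add: emeasure_density)
  ultimately have gauss_1d: "(\<integral>\<^sup>+ t. ennreal (exp (- t\<^sup>2 / (2 * \<sigma>\<^sup>2))) \<partial>lborel) = ennreal (sqrt (2 * pi * \<sigma>\<^sup>2))"
    using c by (simp add: ennreal_mult nn_integral_cmult)
  have "ennreal (exp (- (norm y)\<^sup>2 / (2 * \<sigma>\<^sup>2))) = (\<Prod>b\<in>Basis. ennreal (exp (- (y \<bullet> b)\<^sup>2 / (2 * \<sigma>\<^sup>2))))"
    for y :: "real^'n"
  proof -
    have "(norm y)\<^sup>2 = (\<Sum>b\<in>Basis. (y \<bullet> b)\<^sup>2)"
      unfolding power2_norm_eq_inner using euclidean_inner[of y y] by (simp add: power2_eq_square)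
    then have "- (norm y)\<^sup>2 / (2 * \<sigma>\<^sup>2) = (\<Sum>b\<in>Basis. - (y \<bullet> b)\<^sup>2 / (2 * \<sigma>\<^sup>2))"
      by (simp add: sum_divide_distrib[symmetric] sum_negf)
    then show ?thesis by (simp add: exp_sum prod_ennreal)
  qed
  then have "(\<integral>\<^sup>+ y. ennreal (exp (- (norm (y :: real^'n))\<^sup>2 / (2 * \<sigma>\<^sup>2))) \<partial>lborel)
      = (\<Prod>b\<in>(Basis :: (real^'n) set). \<integral>\<^sup>+ t. ennreal (exp (- t\<^sup>2 / (2 * \<sigma>\<^sup>2))) \<partial>lborel)"
    by (simp only:) (rule nn_integral_lborel_prod, auto)
  then show ?thesis using gauss_1d by (simp add: ennreal_power)
qed

lemma mult_exp_neg_sq_le: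
  fixes t :: real
  shows "t * exp (- t\<^sup>2 / 2) \<le> 2 * exp (- t\<^sup>2 / 4)"
proof -
  have "t \<le> 2 * (1 + t\<^sup>2 / 4)"
    using zero_le_power2[of "t - 1"] by (simp add: power2_eq_square algebra_simps)
  also have "\<dots> \<le> 2 * exp (t\<^sup>2 / 4)" by (rule mult_left_mono) simp_all
  finally have "t * exp (- t\<^sup>2 / 2) \<le> 2 * exp (t\<^sup>2 / 4) * exp (- t\<^sup>2 / 2)"
    by (rule mult_right_mono) simp
  also have "\<dots> = 2 * exp (- t\<^sup>2 / 4)" by (simp add: mult.assoc exp_add[symmetric])
  finally show ?thesis .
qed

lemma sets_gaussian_vec[measurable_cong]: "sets (gaussian_vec C) = sets borel"
  by (simp add: gaussian_vec_def)

lemma gaussian_vec_identity: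
  "gaussian_vec (mat 1 :: real^'n^'n)
    = density lborel (\<lambda>x. ennreal (exp (- (norm x)\<^sup>2 / 2) / sqrt (2 * pi) ^ CARD('n)))"
proof -
  have "matrix_inv (mat 1 :: real^'n^'n) = mat 1" by (rule matrix_inv_unique) simp
  then show ?thesis
    by (simp add: gaussian_vec_def power2_norm_eq_inner real_sqrt_mult power_mult_distrib real_sqrt_power)
qed

lemma prob_space_gaussian_vec_identity: "prob_space (gaussian_vec (mat 1 :: real^'n^'n))"
proof (rule prob_spaceI)
  define c where "c = sqrt (2 * pi) ^ CARD('n)"
  have c: "0 < c" by (simp add: c_def)
  have "(\<integral>\<^sup>+ x. ennreal (exp (- (norm (x :: real^'n))\<^sup>2 / 2) / c) \<partial>lborel)
      = (\<integral>\<^sup>+ x. ennreal (exp (- (norm (x :: real^'n))\<^sup>2 / (2 * 1\<^sup>2))) * ennreal (1 / c) \<partial>lborel)"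
    using c by (intro nn_integral_cong) (simp add: ennreal_mult[symmetric])
  also have "\<dots> = ennreal c * ennreal (1 / c)"
    by (subst nn_integral_multc, simp, subst nn_integral_exp_neg_norm_sq) (simp_all add: c_def)
  also have "\<dots> = 1" using c by (simp add: ennreal_mult[symmetric])
  finally show "emeasure (gaussian_vec (mat 1 :: real^'n^'n)) (space (gaussian_vec (mat 1))) = 1"
    by (simp add: gaussian_vec_identity emeasure_density c_def)
qed

lemma nn_integral_norm_gaussian_vec_identity_finite:
  "(\<integral>\<^sup>+ x. ennreal (norm x) \<partial>gaussian_vec (mat 1 :: real^'n^'n)) < \<infinity>"
proof -
  define c where "c = sqrt (2 * pi) ^ CARD('n)"
  have c: "0 < c" by (simp add: c_def)
  have "(\<integral>\<^sup>+ x. ennreal (norm x) \<partial>gaussian_vec (mat 1 :: real^'n^'n))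
      = (\<integral>\<^sup>+ x. ennreal (exp (- (norm (x :: real^'n))\<^sup>2 / 2) / c * norm x) \<partial>lborel)"
    by (simp add: gaussian_vec_identity nn_integral_density c_def ennreal_mult[symmetric])
  also have "\<dots> \<le> (\<integral>\<^sup>+ x. ennreal (exp (- (norm (x :: real^'n))\<^sup>2 / (2 * (sqrt 2)\<^sup>2))) * ennreal (2 / c) \<partial>lborel)"
  proof (rule nn_integral_mono)
    fix x :: "real^'n"
    have "exp (- (norm x)\<^sup>2 / 2) / c * norm x \<le> exp (- (norm x)\<^sup>2 / (2 * (sqrt 2)\<^sup>2)) * (2 / c)"
      using divide_right_mono[OF mult_exp_neg_sq_le[of "norm x"], of c] c by (simp add: field_simps)
    then show "ennreal (exp (- (norm x)\<^sup>2 / 2) / c * norm x)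
        \<le> ennreal (exp (- (norm x)\<^sup>2 / (2 * (sqrt 2)\<^sup>2))) * ennreal (2 / c)"
      using c by (simp add: ennreal_mult[symmetric] ennreal_leI)
  qed
  also have "\<dots> < \<infinity>"
    by (subst nn_integral_multc, simp, subst nn_integral_exp_neg_norm_sq) (simp_all add: ennreal_mult_less_top)
  finally show ?thesis .
qed

lemma gaussian_vec_matrix_image:
  fixes P :: "real^'n^'n"
  assumes "invertible P"
  shows "gaussian_vec (P ** transpose P) = distr (gaussian_vec (mat 1)) borel ((*v) P)"
proof (rule measure_eqI)
  define Q where "Q = matrix_inv P"
  have PQ: "P ** Q = mat 1" and QP: "Q ** P = mat 1"
    using assms by (simp_all add: Q_def matrix_inv_inverse)
  have "P ** transpose P ** (transpose Q ** Q) = P ** transpose (Q ** P) ** Q"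
    by (simp add: matrix_mul_assoc matrix_transpose_mul)
  then have inv: "matrix_inv (P ** transpose P) = transpose Q ** Q"
    by (intro matrix_inv_unique) (simp add: QP PQ)
  have quad: "(P *v y) \<bullet> (matrix_inv (P ** transpose P) *v (P *v y)) = (norm y)\<^sup>2" for y
  proof -
    have Qy: "Q *v (P *v y) = y" by (simp add: matrix_vector_mul_assoc QP)
    have "(P *v y) \<bullet> (matrix_inv (P ** transpose P) *v (P *v y)) = (P *v y) \<bullet> (y v* Q)"
      by (simp add: inv matrix_vector_mul_assoc[symmetric] Qy)
    also have "\<dots> = y \<bullet> (Q *v (P *v y))" by (metis inner_commute dot_lmul_matrix)
    finally show ?thesis by (simp add: Qy power2_norm_eq_inner)
  qed
  have "det P \<noteq> 0" using assms by (simp add: invertible_det_nz)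
  have det: "sqrt ((2 * pi) ^ CARD('n) * det (P ** transpose P)) = \<bar>det P\<bar> * sqrt (2 * pi) ^ CARD('n)"
    by (simp add: det_mul real_sqrt_mult real_sqrt_power power_mult_distrib)
  define g where "g x = ennreal (exp (- (x \<bullet> (matrix_inv (P ** transpose P) *v x)) / 2)
      / sqrt ((2 * pi) ^ CARD('n) * det (P ** transpose P)))" for x
  have [measurable]: "g \<in> borel_measurable borel" unfolding g_def by measurable
  have g_image: "ennreal \<bar>det P\<bar> * g (P *v y) = ennreal (exp (- (norm y)\<^sup>2 / 2) / sqrt (2 * pi) ^ CARD('n))" for y
    using \<open>det P \<noteq> 0\<close> unfolding g_def quad det by (simp add: ennreal_mult[symmetric])
  fix A assume "A \<in> sets (gaussian_vec (P ** transpose P))"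
  then have A[measurable]: "A \<in> sets borel" by (simp add: gaussian_vec_def)
  have "emeasure (gaussian_vec (P ** transpose P)) A = (\<integral>\<^sup>+ x. g x * indicator A x \<partial>lborel)"
    by (simp add: gaussian_vec_def g_def emeasure_density)
  also have "\<dots> = ennreal \<bar>det P\<bar> * (\<integral>\<^sup>+ y. g (P *v y) * indicator A (P *v y) \<partial>lborel)"
    using \<open>det P \<noteq> 0\<close> by (intro nn_integral_lborel_matrix_change) measurable
  also have "\<dots> = (\<integral>\<^sup>+ y. ennreal (exp (- (norm y)\<^sup>2 / 2) / sqrt (2 * pi) ^ CARD('n))
      * indicator A (P *v y) \<partial>lborel)"
    by (subst nn_integral_cmult[symmetric]) (auto simp: g_image mult.assoc[symmetric] split: split_indicator)
  also have "\<dots> = emeasure (distr (gaussian_vec (mat 1)) borel ((*v) P)) A"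
    using measurable_sets_borel[OF matrix_vector_mult_measurable[of P] A]
    by (subst emeasure_distr)
      (auto simp: gaussian_vec_identity emeasure_density intro!: nn_integral_cong split: split_indicator)
  finally show "emeasure (gaussian_vec (P ** transpose P)) A = emeasure (distr (gaussian_vec (mat 1)) borel ((*v) P)) A" .
qed (simp add: gaussian_vec_def)

lemma exists_form_orthonormal_spanning_set:
  fixes C :: "real^'n^'n"
  assumes sym: "\<And>x y. x \<bullet> (C *v y) = y \<bullet> (C *v x)"
    and pos: "\<And>v. v \<noteq> 0 \<Longrightarrow> v \<bullet> (C *v v) > 0"
    and "finite S"
  shows "\<exists>T. finite T \<and> card T \<le> card S \<and> S \<subseteq> span T \<and> (\<forall>t\<in>T. t \<bullet> (C *v t) = 1)
      \<and> (\<forall>t\<in>T. \<forall>s\<in>T. t \<noteq> s \<longrightarrow> t \<bullet> (C *v s) = 0)"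
  using \<open>finite S\<close>
proof (induction S rule: finite_induct)
  case (insert a S)
  then obtain T where T: "finite T" "card T \<le> card S" "S \<subseteq> span T" "\<forall>t\<in>T. t \<bullet> (C *v t) = 1"
    "\<forall>t\<in>T. \<forall>s\<in>T. t \<noteq> s \<longrightarrow> t \<bullet> (C *v s) = 0" by blast
  define p where "p = (\<Sum>t\<in>T. (a \<bullet> (C *v t)) *\<^sub>R t)"
  have p_span: "p \<in> span T" unfolding p_def by (intro span_sum span_scale span_base)
  have orth: "(a - p) \<bullet> (C *v s) = 0" if s: "s \<in> T" for s
  proof -
    have "p \<bullet> (C *v s) = (\<Sum>t\<in>T. (a \<bullet> (C *v t)) * (t \<bullet> (C *v s)))"
      by (simp add: p_def inner_sum_left)
    also have "\<dots> = (a \<bullet> (C *v s)) * (s \<bullet> (C *v s))"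
      using T(1,5) s by (subst sum.remove[of _ s]) (auto intro!: sum.neutral)
    finally show ?thesis using T(4) s by (simp add: inner_diff_left)
  qed
  show ?case
  proof (cases "a = p")
    case True
    then show ?thesis using T insert(1,2) p_span by (intro exI[of _ T]) (auto simp: card_insert_if)
  next
    case False
    define e where "e = (1 / sqrt ((a - p) \<bullet> (C *v (a - p)))) *\<^sub>R (a - p)"
    have r: "(a - p) \<bullet> (C *v (a - p)) > 0" using pos False by simp
    have ee: "e \<bullet> (C *v e) = 1"
      using r by (simp add: e_def matrix_vector_mult_scaleR power2_eq_square[symmetric])
    have es: "e \<bullet> (C *v s) = 0" if "s \<in> T" for s
      using orth[OF that] by (simp add: e_def)
    have se: "s \<bullet> (C *v e) = 0" if "s \<in> T" for s
      using es[OF that] sym by metis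
    have "e \<notin> T" using es ee by force
    have "a - p = sqrt ((a - p) \<bullet> (C *v (a - p))) *\<^sub>R e" using r by (simp add: e_def)
    then have "a - p \<in> span (insert e T)" by (metis span_scale span_base insertI1)
    then have "a \<in> span (insert e T)"
      using span_mono[of T "insert e T"] p_span span_add[of "a - p" _ p] by auto
    then show ?thesis
      using T insert(1,2) \<open>e \<notin> T\<close> ee es se span_mono[of T "insert e T"]
      by (intro exI[of _ "insert e T"]) auto
  qed
qed (rule exI[of _ "{}"], simp)

lemma pos_def_congruent_identity:
  fixes C :: "real^'n^'n"
  assumes sym: "\<And>x y. x \<bullet> (C *v y) = y \<bullet> (C *v x)"
    and pos: "\<And>v. v \<noteq> 0 \<Longrightarrow> v \<bullet> (C *v v) > 0"
  shows "\<exists>Q :: real^'n^'n. transpose Q ** C ** Q = mat 1"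
proof -
  obtain T where T: "finite T" "card T \<le> card (Basis :: (real^'n) set)" "Basis \<subseteq> span T"
    "\<forall>t\<in>T. t \<bullet> (C *v t) = 1" "\<forall>t\<in>T. \<forall>s\<in>T. t \<noteq> s \<longrightarrow> t \<bullet> (C *v s) = 0"
    using exists_form_orthonormal_spanning_set[OF sym pos, of Basis] by auto
  have "UNIV \<subseteq> span T" using T(3) span_mono[of Basis "span T"] by (simp add: span_span)
  then have "dim (UNIV :: (real^'n) set) \<le> card T" using T(1) by (rule dim_le_card)
  then have "card T = CARD('n)" using T(2) by simp
  then obtain e where e: "bij_betw e (UNIV :: 'n set) T"
    using finite_same_card_bij[of "UNIV :: 'n set" T] T(1) by auto
  have e_form: "e j \<bullet> (C *v e k) = (if j = k then 1 else 0)" for j k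
    using e T(4,5) by (auto simp: bij_betw_def inj_def) metis
  define Q :: "real^'n^'n" where "Q = (\<chi> i j. e j $ i)"
  have Qv: "Q *v y = (\<Sum>j\<in>UNIV. y $ j *\<^sub>R e j)" for y
    by (simp add: matrix_mult_sum Q_def column_def scalar_mult_eq_scaleR)
  have "y \<bullet> ((transpose Q ** C ** Q) *v z) = y \<bullet> z" for y z
  proof -
    have "y \<bullet> ((transpose Q ** C ** Q) *v z) = y \<bullet> ((C *v (Q *v z)) v* Q)"
      by (simp add: matrix_vector_mul_assoc[symmetric])
    also have "\<dots> = (Q *v y) \<bullet> (C *v (Q *v z))"
      by (simp only: inner_commute[of y] dot_lmul_matrix inner_commute[of "C *v _"])
    also have "\<dots> = (\<Sum>j\<in>UNIV. y $ j * (e j \<bullet> (C *v (Q *v z))))"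
      unfolding Qv[of y] by (simp add: inner_sum_left)
    also have "\<dots> = (\<Sum>j\<in>UNIV. y $ j * z $ j)"
    proof (rule sum.cong[OF refl])
      fix j
      have "e j \<bullet> (C *v (Q *v z)) = (\<Sum>k\<in>UNIV. z $ k * (e k \<bullet> (C *v e j)))"
        unfolding sym[of "e j"] Qv[of z] by (simp add: inner_sum_left)
      also have "\<dots> = z $ j" by (simp add: e_form if_distrib cong: if_cong)
      finally show "y $ j * (e j \<bullet> (C *v (Q *v z))) = y $ j * z $ j" by simp
    qed
    also have "\<dots> = y \<bullet> z" by (simp add: inner_vec_def)
    finally show ?thesis .
  qed
  then have "(transpose Q ** C ** Q) *v z = z" for z
    using vector_eq_ldot by blast
  then have "transpose Q ** C ** Q = mat 1"
    by (simp add: matrix_eq)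
  then show ?thesis ..
qed

lemma pos_def_eq_mult_transpose:
  fixes C :: "real^'n^'n"
  assumes "transpose C = C" and "\<And>v. v \<noteq> 0 \<Longrightarrow> v \<bullet> (C *v v) > 0"
  shows "\<exists>P :: real^'n^'n. invertible P \<and> C = P ** transpose P"
proof -
  have "x \<bullet> (C *v y) = y \<bullet> (C *v x)" for x y
    by (metis assms(1) dot_lmul_matrix inner_commute transpose_matrix_vector)
  then obtain Q :: "real^'n^'n" where Q: "transpose Q ** C ** Q = mat 1"
    using pos_def_congruent_identity assms(2) by blast
  then have "invertible Q"
    unfolding invertible_left_inverse by (auto simp: matrix_mul_assoc)
  define P :: "real^'n^'n" where "P = transpose (matrix_inv Q)"
  have PQ: "P ** transpose Q = mat 1"
    using \<open>invertible Q\<close> by (simp add: P_def matrix_transpose_mul[symmetric] matrix_inv_inverse)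
  then have "invertible P" by (auto simp: invertible_right_inverse)
  have "C = (P ** transpose Q) ** C ** (Q ** matrix_inv Q)"
    using PQ \<open>invertible Q\<close> by (simp add: matrix_inv_inverse)
  also have "\<dots> = P ** (transpose Q ** C ** Q) ** matrix_inv Q"
    by (simp add: matrix_mul_assoc)
  also have "\<dots> = P ** transpose P" by (simp add: Q P_def)
  finally show ?thesis using \<open>invertible P\<close> by blast
qed

lemma prob_space_gaussian_vec:
  fixes C :: "real^'n^'n"
  assumes "transpose C = C" and "\<And>v. v \<noteq> 0 \<Longrightarrow> v \<bullet> (C *v v) > 0"
  shows "prob_space (gaussian_vec C)"
proof -
  obtain P :: "real^'n^'n" where "invertible P" "C = P ** transpose P"
    using pos_def_eq_mult_transpose[OF assms] by blast
  moreover have "prob_space (distr (gaussian_vec (mat 1)) borel ((*v) P))"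
    by (rule prob_space.prob_space_distr[OF prob_space_gaussian_vec_identity]) measurable
  ultimately show ?thesis by (simp add: gaussian_vec_matrix_image)
qed

lemma nn_integral_norm_gaussian_vec_finite:
  fixes C :: "real^'n^'n"
  assumes "transpose C = C" and "\<And>v. v \<noteq> 0 \<Longrightarrow> v \<bullet> (C *v v) > 0"
  shows "(\<integral>\<^sup>+ w. ennreal (norm w) \<partial>gaussian_vec C) < \<infinity>"
proof -
  obtain P :: "real^'n^'n" where "invertible P" "C = P ** transpose P"
    using pos_def_eq_mult_transpose[OF assms] by blast
  obtain B where "B > 0" and B: "\<And>y. norm (P *v y) \<le> norm y * B"
    using bounded_linear.pos_bounded[OF matrix_vector_mul_bounded_linear[of P]] by blast
  have "(\<integral>\<^sup>+ w. ennreal (norm w) \<partial>gaussian_vec C)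
      = (\<integral>\<^sup>+ w. ennreal (norm w) \<partial>distr (gaussian_vec (mat 1)) borel ((*v) P))"
    using \<open>invertible P\<close> \<open>C = _\<close> by (simp add: gaussian_vec_matrix_image)
  also have "\<dots> = (\<integral>\<^sup>+ y. ennreal (norm (P *v y)) \<partial>gaussian_vec (mat 1))"
    by (rule nn_integral_distr) measurable
  also have "\<dots> \<le> (\<integral>\<^sup>+ y. ennreal B * ennreal (norm y) \<partial>gaussian_vec (mat 1 :: real^'n^'n))"
    using B \<open>B > 0\<close> by (intro nn_integral_mono) (simp add: ennreal_mult[symmetric] ennreal_leI mult.commute)
  also have "\<dots> < \<infinity>"
    using nn_integral_norm_gaussian_vec_identity_finite[where 'n='n]
    by (simp add: nn_integral_cmult ennreal_mult_less_top)
  finally show ?thesis .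
qed

section \<open>The elliptical slice sampling kernel\<close>

lemma ess_bracket_measurable:
  fixes M :: "(nat \<Rightarrow> real) measure"
  assumes [measurable]: "\<And>i. (\<lambda>u. u i) \<in> borel_measurable M"
  shows "(\<lambda>u. fst (ess_bracket u n)) \<in> borel_measurable M \<and>
    (\<lambda>u. fst (snd (ess_bracket u n))) \<in> borel_measurable M \<and>
    (\<lambda>u. snd (snd (ess_bracket u n))) \<in> borel_measurable M"
proof (induction n)
  case (Suc n)
  then have [measurable]: "(\<lambda>u. fst (ess_bracket u n)) \<in> borel_measurable M"
    "(\<lambda>u. fst (snd (ess_bracket u n))) \<in> borel_measurable M"
    "(\<lambda>u. snd (snd (ess_bracket u n))) \<in> borel_measurable M" by auto
  show ?case by (simp add: Let_def case_prod_beta' if_distrib[of fst] if_distrib[of snd])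
qed simp

abbreviation uniform_seq :: "(nat \<Rightarrow> real) measure" where
  "uniform_seq \<equiv> \<Pi>\<^sub>M i\<in>UNIV. uniform_measure lborel {0..1}"

lemma ess_theta_measurable[measurable]: "(\<lambda>u. ess_theta u n) \<in> borel_measurable uniform_seq"
proof -
  have "(\<lambda>u. u i) \<in> borel_measurable uniform_seq" for i
    by measurable
  then show ?thesis unfolding ess_theta_def using ess_bracket_measurable by blast
qed

lemma ell_measurable[measurable]: "(\<lambda>(w, \<theta>). ell (x :: real^'n) w \<theta>) \<in> borel_measurable borel"
proof -
  have "continuous_on UNIV (\<lambda>p :: (real^'n) \<times> real. ell x (fst p) (snd p))"
    unfolding ell_def by (intro continuous_intros)
  then show ?thesis unfolding case_prod_beta' by (rule borel_measurable_continuous_onI)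
qed

context
  fixes \<rho> :: "real^'n \<Rightarrow> real" and x :: "real^'n"
  assumes \<rho>_measurable[measurable]: "\<rho> \<in> borel_measurable borel"
begin

lemma ess_accepts_measurable[measurable]:
  "Measurable.pred (ess_space C \<rho> x) (\<lambda>\<omega>. ell x (fst \<omega>) (ess_theta (snd (snd \<omega>)) n) \<in> level_set \<rho> (fst (snd \<omega>)))"
proof -
  have "Measurable.pred (ess_space C \<rho> x) (\<lambda>\<omega>. \<rho> ((\<lambda>(w, \<theta>). ell x w \<theta>) (fst \<omega>, ess_theta (snd (snd \<omega>)) n)) \<ge> fst (snd \<omega>))"
    unfolding ess_space_def gaussian_vec_def by measurable
  then show ?thesis by (simp add: level_set_def)
qed

lemma ess_terminates_measurable[measurable]:
  "Measurable.pred (ess_space C \<rho> x) (\<lambda>(w, t, u). ess_terminates \<rho> x w t u)"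
proof -
  have "Measurable.pred (ess_space C \<rho> x)
      (\<lambda>\<omega>. \<exists>n. ell x (fst \<omega>) (ess_theta (snd (snd \<omega>)) n) \<in> level_set \<rho> (fst (snd \<omega>)))"
    by measurable
  then show ?thesis by (simp add: ess_terminates_def case_prod_beta')
qed

lemma ess_output_measurable[measurable]:
  "(\<lambda>(w, t, u). ess_output \<rho> x w t u) \<in> borel_measurable (ess_space C \<rho> x)"
proof -
  let ?y = "\<lambda>n \<omega>. ell x (fst \<omega>) (ess_theta (snd (snd \<omega>)) n)"
  have "(\<lambda>\<omega>. ?y (LEAST n. ?y n \<omega> \<in> level_set \<rho> (fst (snd \<omega>))) \<omega>) \<in> borel_measurable (ess_space C \<rho> x)"
  proof (rule measurable_compose_countable'[where I=UNIV and f="?y"])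
    have "(\<lambda>\<omega>. (\<lambda>(w, \<theta>). ell x w \<theta>) (fst \<omega>, ess_theta (snd (snd \<omega>)) n)) \<in> borel_measurable (ess_space C \<rho> x)"
      for n unfolding ess_space_def gaussian_vec_def by measurable
    then show "?y n \<in> borel_measurable (ess_space C \<rho> x)" for n by simp
    show "(\<lambda>\<omega>. LEAST n. ?y n \<omega> \<in> level_set \<rho> (fst (snd \<omega>))) \<in> measurable (ess_space C \<rho> x) (count_space UNIV)"
      by measurable
  qed simp
  then show ?thesis by (simp add: ess_output_def case_prod_beta')
qed

lemma ess_kernel_eq_distr:
  "ess_kernel C \<rho> x = distr (density (ess_space C \<rho> x) (indicator {(w, t, u). ess_terminates \<rho> x w t u}))
     borel (\<lambda>(w, t, u). ess_output \<rho> x w t u)"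
    (is "_ = distr (density ?S (indicator ?T)) borel ?out")
proof -
  have space: "space ?S = UNIV"
    by (simp add: ess_space_def gaussian_vec_def space_pair_measure space_PiM)
  have "{\<omega> \<in> space ?S. case \<omega> of (w, t, u) \<Rightarrow> ess_terminates \<rho> x w t u} \<in> sets ?S"
    by measurable
  then have T: "?T \<in> sets ?S" by (simp add: space)
  have "ess_kernel C \<rho> x = measure_of UNIV (sets borel) (emeasure (distr (density ?S (indicator ?T)) borel ?out))"
    unfolding ess_kernel_def
  proof (rule measure_of_eq)
    fix A :: "(real^'n) set" assume "A \<in> sigma_sets UNIV (sets borel)"
    then have A: "A \<in> sets borel" by (metis sets.sigma_sets_eq space_borel)
    have B: "?out -` A \<in> sets ?S"
      using measurable_sets[OF ess_output_measurable[where C=C] A] by (simp add: space)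
    have "{(w, t, u) \<in> space ?S. ess_terminates \<rho> x w t u \<and> ess_output \<rho> x w t u \<in> A} = ?T \<inter> ?out -` A"
      by (auto simp: space)
    moreover have "emeasure (distr (density ?S (indicator ?T)) borel ?out) A = emeasure ?S (?T \<inter> ?out -` A)"
      using A B T by (simp add: emeasure_distr emeasure_restricted space)
    ultimately show "emeasure ?S {(w, t, u) \<in> space ?S. ess_terminates \<rho> x w t u \<and> ess_output \<rho> x w t u \<in> A}
        = emeasure (distr (density ?S (indicator ?T)) borel ?out) A"
      by simp
  qed (auto intro: sets.sigma_sets_subset)
  also have "\<dots> = distr (density ?S (indicator ?T)) borel ?out"
    using measure_of_of_measure[of "distr (density ?S (indicator ?T)) borel ?out"] by simp
  finally show ?thesis .
qed

lemma nn_integral_ess_kernel: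
  assumes [measurable]: "f \<in> borel_measurable borel"
  shows "(\<integral>\<^sup>+ y. f y \<partial>ess_kernel C \<rho> x)
    = (\<integral>\<^sup>+ (w, t, u). (if ess_terminates \<rho> x w t u then f (ess_output \<rho> x w t u) else 0) \<partial>ess_space C \<rho> x)"
proof -
  let ?T = "{(w, t, u). ess_terminates \<rho> x w t u}"
  have "{\<omega> \<in> space (ess_space C \<rho> x). case \<omega> of (w, t, u) \<Rightarrow> ess_terminates \<rho> x w t u} \<in> sets (ess_space C \<rho> x)"
    by measurable
  then have [measurable]: "?T \<in> sets (ess_space C \<rho> x)"
    by (simp add: ess_space_def gaussian_vec_def space_pair_measure space_PiM)
  have "(\<integral>\<^sup>+ y. f y \<partial>ess_kernel C \<rho> x)
      = (\<integral>\<^sup>+ \<omega>. f (case \<omega> of (w, t, u) \<Rightarrow> ess_output \<rho> x w t u) \<partial>density (ess_space C \<rho> x) (indicator ?T))"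
    unfolding ess_kernel_eq_distr by (rule nn_integral_distr) simp_all
  also have "\<dots> = (\<integral>\<^sup>+ \<omega>. indicator ?T \<omega> * f (case \<omega> of (w, t, u) \<Rightarrow> ess_output \<rho> x w t u) \<partial>ess_space C \<rho> x)"
    by (rule nn_integral_density) simp_all
  also have "\<dots> = (\<integral>\<^sup>+ (w, t, u). (if ess_terminates \<rho> x w t u then f (ess_output \<rho> x w t u) else 0) \<partial>ess_space C \<rho> x)"
    by (intro nn_integral_cong) (auto simp: indicator_def)
  finally show ?thesis .
qed

end

section \<open>The drift bound\<close>

lemma norm_ell_le: "norm (ell x w \<theta>) \<le> \<bar>cos \<theta>\<bar> * norm x + norm w"
proof -
  have "norm (ell x w \<theta>) \<le> norm (cos \<theta> *\<^sub>R x) + norm (sin \<theta> *\<^sub>R w)"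
    unfolding ell_def by (rule norm_triangle_ineq)
  also have "norm (sin \<theta> *\<^sub>R w) \<le> norm w"
    using abs_sin_le_one[of \<theta>] by (simp add: mult_left_le_one_le)
  finally show ?thesis by simp
qed

lemma abs_cos_le_near_quarter_turn:
  fixes \<alpha> v :: real
  assumes "0 < \<alpha>" "\<alpha> \<le> 1" and v: "v \<in> {1/4 - \<alpha>/(4*pi) .. 1/4}"
  shows "\<bar>cos (2 * pi * v)\<bar> \<le> \<alpha>/2"
proof -
  define s where "s = pi/2 - 2 * pi * v"
  have s: "0 \<le> s" "s \<le> \<alpha>/2" using v pi_gt_zero by (auto simp: s_def field_simps)
  have "cos (2 * pi * v) = sin s" by (simp add: s_def cos_sin_eq)
  moreover have "0 \<le> sin s" using s assms pi_ge_two by (intro sin_ge_zero) auto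
  moreover have "sin s \<le> s" using s by (intro sin_x_le_x)
  ultimately show ?thesis using s by simp
qed

lemma ess_output_first_proposal:
  assumes "ell x w (ess_theta u 0) \<in> level_set \<rho> t"
  shows "ess_output \<rho> x w t u = ell x w (2 * pi * u 0)"
  using assms by (simp add: ess_output_def ess_theta_def)

text \<open>
  The coefficient of \<open>|x|\<close> in the bound on the output as a function of the first uniform draw;
  the interval consists of the draws whose proposed angle lies within \<open>\<alpha>/2\<close> below \<open>pi/2\<close>.
\<close>

definition contraction :: "real \<Rightarrow> real \<Rightarrow> real" where
  "contraction \<alpha> v = 1 - (1 - \<alpha>/2) * indicator {1/4 - \<alpha>/(4*pi) .. 1/4} v"

definition drift_rate :: "real \<Rightarrow> real" where
  "drift_rate \<alpha> = 1 - (1 - \<alpha>/2) * (\<alpha> / (4*pi))"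

lemma drift_rate_bounds:
  assumes "0 < \<alpha>" "\<alpha> \<le> 1"
  shows "0 \<le> drift_rate \<alpha>" and "drift_rate \<alpha> < 1"
proof -
  have "(1 - \<alpha>/2) * (\<alpha> / (4*pi)) \<le> 1 * 1"
    using assms pi_gt3 by (intro mult_mono) (auto simp: field_simps)
  then show "0 \<le> drift_rate \<alpha>" by (simp add: drift_rate_def)
  show "drift_rate \<alpha> < 1" using assms by (simp add: drift_rate_def)
qed

lemma contraction_nonneg:
  assumes "0 < \<alpha>" "\<alpha> \<le> 1"
  shows "0 \<le> contraction \<alpha> v"
  using assms by (simp add: contraction_def indicator_def)

lemma norm_ess_output_le:
  assumes ball: "\<And>x. norm x > R \<Longrightarrow> cball 0 (\<alpha> * norm x) \<subseteq> level_set \<rho> (\<rho> x)"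
    and \<alpha>: "0 < \<alpha>" "\<alpha> \<le> 1" and "0 \<le> R" and "t \<le> \<rho> x"
  shows "norm (ess_output \<rho> x w t u) \<le> contraction \<alpha> (u 0) * norm x + (1 + 2/\<alpha>) * norm w + R"
proof -
  have "norm (ell x w \<theta>) \<le> norm x + norm w" for \<theta>
  proof -
    have "\<bar>cos \<theta>\<bar> * norm x \<le> norm x" by (simp add: mult_left_le_one_le)
    then show ?thesis using norm_ell_le[of x w \<theta>] by linarith
  qed
  then have trivial: "norm (ess_output \<rho> x w t u) \<le> norm x + norm w" by (simp add: ess_output_def)
  have K: "(1 + 2/\<alpha>) * norm w = norm w + 2/\<alpha> * norm w" by (simp add: algebra_simps)
  have "0 \<le> 2/\<alpha> * norm w" "0 \<le> \<alpha>/2 * norm x" using \<alpha> by simp_all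
  show ?thesis
  proof (cases "u 0 \<in> {1/4 - \<alpha>/(4*pi) .. 1/4}")
    case False
    then show ?thesis
      using trivial K \<open>0 \<le> 2/\<alpha> * norm w\<close> \<open>0 \<le> R\<close> by (simp add: contraction_def)
  next
    case True
    then have c: "contraction \<alpha> (u 0) = \<alpha>/2" by (simp add: contraction_def)
    consider "norm x \<le> R" | "\<alpha>/2 * norm x < norm w" | "R < norm x" "norm w \<le> \<alpha>/2 * norm x"
      by linarith
    then show ?thesis
    proof cases
      case 1
      then show ?thesis
        unfolding c using trivial K \<open>0 \<le> 2/\<alpha> * norm w\<close> \<open>0 \<le> \<alpha>/2 * norm x\<close> by linarith
    next
      case 2
      then have "norm x \<le> 2/\<alpha> * norm w" using \<alpha> by (simp add: field_simps)
      then show ?thesis unfolding c using trivial K \<open>0 \<le> R\<close> \<open>0 \<le> \<alpha>/2 * norm x\<close> by linarith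
    next
      case 3
      have "\<bar>cos (2 * pi * u 0)\<bar> * norm x \<le> \<alpha>/2 * norm x"
        using abs_cos_le_near_quarter_turn[OF \<alpha> True] by (rule mult_right_mono) simp
      then have small: "norm (ell x w (2 * pi * u 0)) \<le> \<alpha>/2 * norm x + norm w"
        using norm_ell_le[of x w "2 * pi * u 0"] by linarith
      with 3 have "ell x w (ess_theta u 0) \<in> cball 0 (\<alpha> * norm x)"
        by (simp add: ess_theta_def)
      then have "ell x w (ess_theta u 0) \<in> level_set \<rho> t"
        using ball[OF \<open>R < norm x\<close>] \<open>t \<le> \<rho> x\<close> by (auto simp: level_set_def)
      then have "ess_output \<rho> x w t u = ell x w (2 * pi * u 0)" by (rule ess_output_first_proposal)
      with small have "norm (ess_output \<rho> x w t u) \<le> \<alpha>/2 * norm x + norm w" by simp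
      then show ?thesis
        unfolding c using K \<open>0 \<le> 2/\<alpha> * norm w\<close> \<open>0 \<le> R\<close> by linarith
    qed
  qed
qed

lemma nn_integral_contraction:
  assumes "0 < \<alpha>" "\<alpha> \<le> 1" "0 \<le> c"
  shows "(\<integral>\<^sup>+ v. ennreal (contraction \<alpha> v * c) \<partial>uniform_measure lborel {0..1}) = ennreal (drift_rate \<alpha> * c)"
proof -
  let ?I = "{1/4 - \<alpha>/(4*pi) .. 1/4}"
  have "\<alpha>/(4*pi) \<le> 1/4" using assms pi_gt3 by (simp add: field_simps)
  then have I: "?I \<subseteq> {0..1}" "measure lborel ?I = \<alpha>/(4*pi)" using assms by auto
  interpret prob_space "uniform_measure lborel {0..1::real}"
    by (intro prob_space_uniform_measure) auto
  have "0 \<le> contraction \<alpha> v" "contraction \<alpha> v \<le> 1" for v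
    using assms by (simp_all add: contraction_def indicator_def)
  then have bound: "0 \<le> contraction \<alpha> v * c" "contraction \<alpha> v * c \<le> c" for v
    using \<open>0 \<le> c\<close> by (simp_all add: mult_left_le_one_le)
  have "contraction \<alpha> \<in> borel_measurable borel" unfolding contraction_def by measurable
  then have "integrable (uniform_measure lborel {0..1}) (\<lambda>v. contraction \<alpha> v * c)"
    by (intro integrable_const_bound[where B=c]) (simp_all add: bound)
  then have "(\<integral>\<^sup>+ v. ennreal (contraction \<alpha> v * c) \<partial>uniform_measure lborel {0..1})
      = ennreal (\<integral> v. contraction \<alpha> v * c \<partial>uniform_measure lborel {0..1})"
    by (intro nn_integral_eq_integral) (simp_all add: bound)
  also have "(\<integral> v. contraction \<alpha> v * c \<partial>uniform_measure lborel {0..1})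
      = (\<integral> v. c - ((1 - \<alpha>/2) * c) * indicator ?I v \<partial>uniform_measure lborel {0..1})"
    by (simp add: contraction_def algebra_simps)
  also have "\<dots> = c - (1 - \<alpha>/2) * c * prob ?I"
    using integrable_const_bound[where B=1 and f="indicator ?I :: real \<Rightarrow> real"]
    by (simp add: prob_space)
  also have "prob ?I = \<alpha>/(4*pi)"
    using I by (subst measure_uniform_measure) (auto simp: Int_absorb1)
  also have "c - (1 - \<alpha>/2) * c * (\<alpha>/(4*pi)) = drift_rate \<alpha> * c"
    by (simp only: drift_rate_def left_diff_distrib right_diff_distrib mult_1 mult_1_right ac_simps)
  finally show ?thesis .
qed

lemma (in prob_space) distr_pair_snd:
  assumes "prob_space N"
  shows "distr (N \<Otimes>\<^sub>M M) M snd = M"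
proof (intro measure_eqI)
  interpret N: prob_space N by fact
  fix A assume A: "A \<in> sets (distr (N \<Otimes>\<^sub>M M) M snd)"
  then have "emeasure (distr (N \<Otimes>\<^sub>M M) M snd) A = emeasure (N \<Otimes>\<^sub>M M) (space N \<times> A)"
    by (auto simp: emeasure_distr space_pair_measure dest: sets.sets_into_space
        intro!: arg_cong2[where f=emeasure])
  with A show "emeasure (distr (N \<Otimes>\<^sub>M M) M snd) A = emeasure M A"
    by (simp add: emeasure_pair_measure_Times N.emeasure_space_1)
qed simp

lemma prob_space_uniform_seq: "prob_space uniform_seq"
  by (intro prob_space_PiM prob_space_uniform_measure) auto

context
  fixes C :: "real^'n^'n" and \<rho> :: "real^'n \<Rightarrow> real" and x :: "real^'n"
  assumes \<rho>_pos: "0 < \<rho> x"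
begin

lemma prob_space_uniform_threshold: "prob_space (uniform_measure lborel {0..\<rho> x})"
  using \<rho>_pos by (intro prob_space_uniform_measure) auto

lemma prob_space_ess_space: "prob_space (gaussian_vec C) \<Longrightarrow> prob_space (ess_space C \<rho> x)"
  unfolding ess_space_def
  by (intro prob_space_pair prob_space_uniform_threshold prob_space_uniform_seq)

lemma distr_ess_space_fst: "distr (ess_space C \<rho> x) (gaussian_vec C) fst = gaussian_vec C"
  unfolding ess_space_def
  by (intro prob_space.distr_pair_fst prob_space_pair prob_space_uniform_threshold prob_space_uniform_seq)

lemma distr_ess_space_snd:
  assumes "prob_space (gaussian_vec C)"
  shows "distr (ess_space C \<rho> x) (uniform_measure lborel {0..\<rho> x} \<Otimes>\<^sub>M uniform_seq) snd
    = uniform_measure lborel {0..\<rho> x} \<Otimes>\<^sub>M uniform_seq"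
  unfolding ess_space_def
  by (intro prob_space.distr_pair_snd prob_space_pair assms prob_space_uniform_threshold prob_space_uniform_seq)

lemma nn_integral_ess_space_fst:
  assumes [measurable]: "f \<in> borel_measurable borel"
  shows "(\<integral>\<^sup>+ \<omega>. f (fst \<omega>) \<partial>ess_space C \<rho> x) = (\<integral>\<^sup>+ w. f w \<partial>gaussian_vec C)"
proof -
  have "fst \<in> measurable (ess_space C \<rho> x) (gaussian_vec C)" by (simp add: ess_space_def)
  moreover have "f \<in> borel_measurable (gaussian_vec C)"
    by (simp add: measurable_cong_sets[OF sets_gaussian_vec])
  ultimately show ?thesis by (simp add: nn_integral_distr[symmetric] distr_ess_space_fst)
qed

lemma nn_integral_ess_space_first_draw:
  assumes gaussian: "prob_space (gaussian_vec C)" and [measurable]: "f \<in> borel_measurable borel"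
  shows "(\<integral>\<^sup>+ \<omega>. f (snd (snd \<omega>) 0) \<partial>ess_space C \<rho> x) = (\<integral>\<^sup>+ v. f v \<partial>uniform_measure lborel {0..1})"
proof -
  let ?U = "uniform_measure lborel {0..\<rho> x}"
  have "snd \<in> measurable (ess_space C \<rho> x) (?U \<Otimes>\<^sub>M uniform_seq)" by (simp add: ess_space_def)
  then have "(\<integral>\<^sup>+ \<omega>. f (snd (snd \<omega>) 0) \<partial>ess_space C \<rho> x)
      = (\<integral>\<^sup>+ p. f (snd p 0) \<partial>distr (ess_space C \<rho> x) (?U \<Otimes>\<^sub>M uniform_seq) snd)"
    by (simp add: nn_integral_distr)
  also have "\<dots> = (\<integral>\<^sup>+ p. f (snd p 0) \<partial>(?U \<Otimes>\<^sub>M uniform_seq))"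
    unfolding distr_ess_space_snd[OF gaussian] ..
  also have "\<dots> = (\<integral>\<^sup>+ u. f (u 0) \<partial>uniform_seq)"
    using nn_integral_distr[of snd "?U \<Otimes>\<^sub>M uniform_seq" uniform_seq "\<lambda>u. f (u 0)"]
    by (simp add: prob_space.distr_pair_snd[OF prob_space_uniform_seq prob_space_uniform_threshold])
  also have "\<dots> = (\<integral>\<^sup>+ v. f v \<partial>distr uniform_seq (uniform_measure lborel {0..1}) (\<lambda>u. u 0))"
    by (simp add: nn_integral_distr)
  also have "\<dots> = (\<integral>\<^sup>+ v. f v \<partial>uniform_measure lborel {0..1})"
    by (subst distr_PiM_component) (auto intro: prob_space_uniform_measure)
  finally show ?thesis .
qed

lemma AE_ess_space_threshold:
  assumes gaussian: "prob_space (gaussian_vec C)"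
  shows "AE \<omega> in ess_space C \<rho> x. fst (snd \<omega>) \<le> \<rho> x"
proof -
  let ?U = "uniform_measure lborel {0..\<rho> x}"
  have distr_fst: "distr (?U \<Otimes>\<^sub>M uniform_seq) ?U fst = ?U"
    by (rule prob_space.distr_pair_fst[OF prob_space_uniform_seq])
  have "AE t in ?U. t \<le> \<rho> x" by (rule AE_uniform_measureI) auto
  then have "AE t in distr (?U \<Otimes>\<^sub>M uniform_seq) ?U fst. t \<le> \<rho> x" unfolding distr_fst .
  then have "AE p in ?U \<Otimes>\<^sub>M uniform_seq. fst p \<le> \<rho> x" by (rule AE_distrD[rotated]) simp
  then have "AE p in distr (ess_space C \<rho> x) (?U \<Otimes>\<^sub>M uniform_seq) snd. fst p \<le> \<rho> x"
    unfolding distr_ess_space_snd[OF gaussian] .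
  then show ?thesis by (rule AE_distrD[rotated]) (simp add: ess_space_def)
qed

lemma nn_integral_ess_space_bound:
  assumes gaussian: "prob_space (gaussian_vec C)"
    and \<alpha>: "0 < \<alpha>" "\<alpha> \<le> 1" and "0 \<le> K" "0 \<le> R" "0 \<le> m"
    and moment: "(\<integral>\<^sup>+ w. ennreal (norm w) \<partial>gaussian_vec C) = ennreal m"
  shows "(\<integral>\<^sup>+ \<omega>. ennreal (contraction \<alpha> (snd (snd \<omega>) 0) * norm x) + ennreal (K * norm (fst \<omega>)) + ennreal R
      \<partial>ess_space C \<rho> x) = ennreal (drift_rate \<alpha> * norm x + (K * m + R))"
proof -
  let ?S = "ess_space C \<rho> x"
  have [measurable]: "contraction \<alpha> \<in> borel_measurable borel"
    unfolding contraction_def by measurable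
  have [measurable]: "(\<lambda>\<omega>. ennreal (contraction \<alpha> (snd (snd \<omega>) 0) * norm x)) \<in> borel_measurable ?S"
    unfolding ess_space_def by measurable
  have [measurable]: "(\<lambda>\<omega>. ennreal (K * norm (fst \<omega>))) \<in> borel_measurable ?S"
    unfolding ess_space_def gaussian_vec_def by measurable
  have "(\<integral>\<^sup>+ \<omega>. ennreal (contraction \<alpha> (snd (snd \<omega>) 0) * norm x) + ennreal (K * norm (fst \<omega>)) + ennreal R \<partial>?S)
      = (\<integral>\<^sup>+ \<omega>. ennreal (contraction \<alpha> (snd (snd \<omega>) 0) * norm x) \<partial>?S)
        + (\<integral>\<^sup>+ \<omega>. ennreal (K * norm (fst \<omega>)) \<partial>?S) + (\<integral>\<^sup>+ \<omega>. ennreal R \<partial>?S)"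
    by (subst nn_integral_add, measurable, subst nn_integral_add) measurable
  also have "(\<integral>\<^sup>+ \<omega>. ennreal (contraction \<alpha> (snd (snd \<omega>) 0) * norm x) \<partial>?S)
      = (\<integral>\<^sup>+ v. ennreal (contraction \<alpha> v * norm x) \<partial>uniform_measure lborel {0..1})"
    by (rule nn_integral_ess_space_first_draw[OF gaussian]) measurable
  also have "\<dots> = ennreal (drift_rate \<alpha> * norm x)"
    using \<alpha> by (simp add: nn_integral_contraction)
  also have "(\<integral>\<^sup>+ \<omega>. ennreal (K * norm (fst \<omega>)) \<partial>?S) = (\<integral>\<^sup>+ w. ennreal (K * norm w) \<partial>gaussian_vec C)"
    by (rule nn_integral_ess_space_fst) measurable
  also have "\<dots> = ennreal (K * m)"
    using \<open>0 \<le> K\<close> \<open>0 \<le> m\<close> moment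
    by (simp add: ennreal_mult nn_integral_cmult measurable_cong_sets[OF sets_gaussian_vec])
  also have "(\<integral>\<^sup>+ \<omega>. ennreal R \<partial>?S) = ennreal R"
    using prob_space.emeasure_space_1[OF prob_space_ess_space[OF gaussian]] by simp
  also have "ennreal (drift_rate \<alpha> * norm x) + ennreal (K * m) + ennreal R
      = ennreal (drift_rate \<alpha> * norm x + (K * m + R))"
    using drift_rate_bounds[OF \<alpha>] \<open>0 \<le> K\<close> \<open>0 \<le> m\<close> \<open>0 \<le> R\<close> by (simp add: add.assoc)
  finally show ?thesis .
qed

end

lemma nn_integral_norm_ess_kernel_le:
  fixes C :: "real^'n^'n" and \<rho> :: "real^'n \<Rightarrow> real"
  assumes [measurable]: "\<rho> \<in> borel_measurable borel" and "0 < \<rho> x"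
    and \<alpha>: "0 < \<alpha>" "\<alpha> \<le> 1" and "0 \<le> R"
    and ball: "\<And>x. norm x > R \<Longrightarrow> cball 0 (\<alpha> * norm x) \<subseteq> level_set \<rho> (\<rho> x)"
    and gaussian: "prob_space (gaussian_vec C)"
    and moment: "(\<integral>\<^sup>+ w. ennreal (norm w) \<partial>gaussian_vec C) = ennreal m" and "0 \<le> m"
  shows "(\<integral>\<^sup>+ y. ennreal (norm y) \<partial>ess_kernel C \<rho> x)
    \<le> ennreal (drift_rate \<alpha> * norm x + ((1 + 2/\<alpha>) * m + R))"
proof -
  let ?K = "1 + 2/\<alpha>"
  have "0 < ?K" using \<alpha> by (simp add: add_pos_pos)
  have pointwise: "(if ess_terminates \<rho> x w t u then ennreal (norm (ess_output \<rho> x w t u)) else 0)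
      \<le> ennreal (contraction \<alpha> (u 0) * norm x) + ennreal (?K * norm w) + ennreal R"
    if "t \<le> \<rho> x" for w t u
  proof -
    have "norm (ess_output \<rho> x w t u) \<le> contraction \<alpha> (u 0) * norm x + ?K * norm w + R"
      using norm_ess_output_le[where R=R and \<alpha>=\<alpha> and \<rho>=\<rho> and t=t and x=x and w=w and u=u]
        ball \<alpha> \<open>0 \<le> R\<close> that by blast
    then have "ennreal (norm (ess_output \<rho> x w t u)) \<le> ennreal (contraction \<alpha> (u 0) * norm x + ?K * norm w + R)"
      by (rule ennreal_leI)
    also have "\<dots> = ennreal (contraction \<alpha> (u 0) * norm x) + ennreal (?K * norm w) + ennreal R"
      using contraction_nonneg[OF \<alpha>, of "u 0"] \<open>0 < ?K\<close> \<open>0 \<le> R\<close> by simp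
    finally show ?thesis by simp
  qed
  have "(\<integral>\<^sup>+ y. ennreal (norm y) \<partial>ess_kernel C \<rho> x)
      = (\<integral>\<^sup>+ (w, t, u). (if ess_terminates \<rho> x w t u then ennreal (norm (ess_output \<rho> x w t u)) else 0)
          \<partial>ess_space C \<rho> x)"
    by (rule nn_integral_ess_kernel) measurable
  also have "\<dots> \<le> (\<integral>\<^sup>+ \<omega>. ennreal (contraction \<alpha> (snd (snd \<omega>) 0) * norm x) + ennreal (?K * norm (fst \<omega>))
      + ennreal R \<partial>ess_space C \<rho> x)"
  proof (rule nn_integral_mono_AE)
    show "AE \<omega> in ess_space C \<rho> x.
        (case \<omega> of (w, t, u) \<Rightarrow> if ess_terminates \<rho> x w t u then ennreal (norm (ess_output \<rho> x w t u)) else 0)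
        \<le> ennreal (contraction \<alpha> (snd (snd \<omega>) 0) * norm x) + ennreal (?K * norm (fst \<omega>)) + ennreal R"
      using AE_ess_space_threshold[where C=C and \<rho>=\<rho> and x=x, OF \<open>0 < \<rho> x\<close> gaussian]
    proof eventually_elim
      case (elim \<omega>)
      obtain w t u where "\<omega> = (w, t, u)" by (cases \<omega>)
      with elim show ?case using pointwise[of t w u] by simp
    qed
  qed
  also have "\<dots> = ennreal (drift_rate \<alpha> * norm x + (?K * m + R))"
    using \<open>0 < ?K\<close> \<open>0 \<le> R\<close> \<open>0 \<le> m\<close> moment
    by (intro nn_integral_ess_space_bound[where C=C and \<rho>=\<rho> and x=x, OF \<open>0 < \<rho> x\<close> gaussian \<alpha>]) simp_all
  finally show ?thesis .
qed

theorem lemma1: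
  fixes C :: "real^'n^'n" and \<rho> :: "real^'n \<Rightarrow> real"
  assumes C_sym: "transpose C = C"
    and C_pd: "\<And>v. v \<noteq> 0 \<Longrightarrow> v \<bullet> (C *v v) > 0"
    and \<rho>_meas: "\<rho> \<in> borel_measurable borel"
    and \<rho>_pos: "\<And>x. \<rho> x > 0"
    and \<alpha>: "0 < \<alpha>" "\<alpha> \<le> 1 / sqrt 2"
    and R: "R > 0"
    and ball: "\<And>x. norm x > R \<Longrightarrow> cball 0 (\<alpha> * norm x) \<subseteq> level_set \<rho> (\<rho> x)"
  shows "\<exists>\<delta> L. 0 \<le> \<delta> \<and> \<delta> < 1 \<and> 0 \<le> L \<and>
           (\<forall>x. (\<integral>\<^sup>+ y. ennreal (norm y) \<partial>ess_kernel C \<rho> x) \<le> ennreal (\<delta> * norm x + L))"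
proof -
  have "\<alpha> \<le> 1"
    using \<alpha>(2) by (smt (verit) real_sqrt_ge_one divide_le_eq_1)
  obtain m where "0 \<le> m" and moment: "(\<integral>\<^sup>+ w. ennreal (norm w) \<partial>gaussian_vec C) = ennreal m"
    using nn_integral_norm_gaussian_vec_finite[OF C_sym C_pd] by (auto simp: less_top_ennreal)
  have "(\<integral>\<^sup>+ y. ennreal (norm y) \<partial>ess_kernel C \<rho> x) \<le> ennreal (drift_rate \<alpha> * norm x + ((1 + 2/\<alpha>) * m + R))"
    for x
    using \<rho>_meas \<rho>_pos \<alpha>(1) \<open>\<alpha> \<le> 1\<close> R ball prob_space_gaussian_vec[OF C_sym C_pd] moment \<open>0 \<le> m\<close>
    by (intro nn_integral_norm_ess_kernel_le) auto
  moreover have "0 \<le> (1 + 2/\<alpha>) * m + R" using \<alpha>(1) R \<open>0 \<le> m\<close> by simp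
  ultimately show ?thesis
    using drift_rate_bounds[OF \<alpha>(1) \<open>\<alpha> \<le> 1\<close>] by blast
qed

end
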